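(* Let $\Delta$ be a rank 2 root system and let $\Gamma$ be a nonempty set of real roots in $\Delta$. (i) If $\Delta$ is finite, then $\Phi(\Gamma)$ is finite. (ii) If $\Delta$ is affine of type $\widetilde{A}_1$, then $\Phi(\Gamma)$ has finite type $A_1$ or affine type $\widetilde{A}_1$. (iii) If $\Delta$ is affine of type $\widetilde{A}_2^{(2)}$, then $\Phi(\Gamma)$ has finite type $A_1$, or affine type $\widetilde{A}_1$ or $\widetilde{A}_2^{(2)}$. (iv) If $\Delta$ is hyperbolic, then $\Phi(\Gamma)$ has finite type $A_1$ or hyperbolic type.
   Context: For integers $m,n\ge1$ let $H(m,n)=\begin{pmatrix}2&-n\\-m&2\end{pmatrix}$. A rank 2 root system $\Delta$ is the root system of the Kac--Moody algebra with generalized Cartan matrix $H(a,b)$, $a\ge b\ge1$; it is finite if $ab<4$, affine if $ab=4$ (type $\widetilde A_1$ for $H(2,2)$, type $\widetilde A_2^{(2)}$ for $H(4,1)$), and hyperbolic if $ab>4$. Simple roots are $\alpha_1,\alpha_2$; simple reflections $w_1(\alpha_1)=-\alpha_1$, $w_1(\alpha_2)=\alpha_2+b\alpha_1$, $w_2(\alpha_1)=\alpha_1+a\alpha_2$, $w_2(\alpha_2)=-\alpha_2$; $W=\langle w_1,w_2\rangle$; symmetric bilinear form $(\alpha_1,\alpha_1)=2a/b$, $(\alpha_1,\alpha_2)=-a$, $(\alpha_2,\alpha_2)=2$; real roots $\Delta^{\mathrm{re}}=W\alpha_1\cup W\alpha_2$. For a real root $\alpha$, $w_\alpha(\beta)=\beta-\frac{2(\beta,\alpha)}{(\alpha,\alpha)}\alpha$.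 For $\Gamma\subseteq\Delta^{\mathrm{re}}$: $W_\Gamma=\langle w_\alpha:\alpha\in\Gamma\rangle$ and $\Phi(\Gamma)=W_\Gamma\cdot\Gamma$. $\Phi(\Gamma)$ has type $A_1$ if $\Phi(\Gamma)=\{\pm\beta\}$ for a real root $\beta$. It has type $H(m,n)$ if it has a basis of simple roots $\{\beta_1,\beta_2\}\subseteq\Phi(\Gamma)$ (so $\Phi(\Gamma)=W_{\{\beta_1,\beta_2\}}\cdot\{\beta_1,\beta_2\}$ and every element of $\Phi(\Gamma)$ is a nonnegative or nonpositive integer combination of $\beta_1,\beta_2$) with Cartan matrix $\left(\frac{2(\beta_i,\beta_j)}{(\beta_i,\beta_i)}\right)_{i,j}=H(m,n)$; this is of type $\widetilde A_1$ for $H(2,2)$, type $\widetilde A_2^{(2)}$ for $H(4,1)$, and hyperbolic type if $mn>4$. *)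

theory Defs
  imports "HOL-Analysis.Analysis" "HOL-Algebra.Bij" "HOL-Algebra.Generated_Groups"
begin

definition H :: "nat \<Rightarrow> nat \<Rightarrow> real^2^2" where
  "H m n = vector [vector [2, - real n], vector [- real m, 2]]"

text \<open>
  The ambient space of the root system of \<open>H(a,b)\<close> is the real span of the simple roots;
  the pair \<open>(x, y)\<close> stands for the vector \<open>x \<alpha>\<^sub>1 + y \<alpha>\<^sub>2\<close>.
\<close>

type_synonym root_space = "real \<times> real"

definition alpha1 :: root_space where "alpha1 = (1, 0)"

definition alpha2 :: root_space where "alpha2 = (0, 1)"

text \<open>
  The linear maps with \<open>w\<^sub>1 \<alpha>\<^sub>1 = - \<alpha>\<^sub>1\<close>, \<open>w\<^sub>1 \<alpha>\<^sub>2 = \<alpha>\<^sub>2 + b \<alpha>\<^sub>1\<close>,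
  \<open>w\<^sub>2 \<alpha>\<^sub>1 = \<alpha>\<^sub>1 + a \<alpha>\<^sub>2\<close>, \<open>w\<^sub>2 \<alpha>\<^sub>2 = - \<alpha>\<^sub>2\<close>.
\<close>

definition w1 :: "nat \<Rightarrow> nat \<Rightarrow> root_space \<Rightarrow> root_space" where
  "w1 a b v = fst v *\<^sub>R (- alpha1) + snd v *\<^sub>R (alpha2 + real b *\<^sub>R alpha1)"

definition w2 :: "nat \<Rightarrow> nat \<Rightarrow> root_space \<Rightarrow> root_space" where
  "w2 a b v = fst v *\<^sub>R (alpha1 + real a *\<^sub>R alpha2) + snd v *\<^sub>R (- alpha2)"

text \<open>
  The symmetric bilinear form with \<open>(\<alpha>\<^sub>1, \<alpha>\<^sub>1) = 2a/b\<close>, \<open>(\<alpha>\<^sub>1, \<alpha>\<^sub>2) = -a\<close> and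
  \<open>(\<alpha>\<^sub>2, \<alpha>\<^sub>2) = 2\<close>.
\<close>

definition form :: "nat \<Rightarrow> nat \<Rightarrow> root_space \<Rightarrow> root_space \<Rightarrow> real" where
  "form a b u v =
     (2 * real a / real b) * (fst u * fst v)
     - real a * (fst u * snd v + snd u * fst v)
     + 2 * (snd u * snd v)"

definition reflection :: "nat \<Rightarrow> nat \<Rightarrow> root_space \<Rightarrow> root_space \<Rightarrow> root_space" where
  "reflection a b \<alpha> \<beta> = \<beta> - (2 * form a b \<beta> \<alpha> / form a b \<alpha> \<alpha>) *\<^sub>R \<alpha>"

text \<open>
  Groups of transformations are subgroups of the group of all bijections of the ambient space.
  On \<open>UNIV\<close> the extensionality requirement of \<open>BijGroup\<close> is vacuous, so its
  multiplication is plain composition.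
\<close>

definition generated_group :: "(root_space \<Rightarrow> root_space) set \<Rightarrow> (root_space \<Rightarrow> root_space) set" where
  "generated_group S = generate (BijGroup UNIV) S"

definition weyl_group :: "nat \<Rightarrow> nat \<Rightarrow> (root_space \<Rightarrow> root_space) set" where
  "weyl_group a b = generated_group {w1 a b, w2 a b}"

definition real_roots :: "nat \<Rightarrow> nat \<Rightarrow> root_space set" where
  "real_roots a b =
     {w alpha1 | w. w \<in> weyl_group a b} \<union> {w alpha2 | w. w \<in> weyl_group a b}"

definition W_sub :: "nat \<Rightarrow> nat \<Rightarrow> root_space set \<Rightarrow> (root_space \<Rightarrow> root_space) set" where
  "W_sub a b \<Gamma> = generated_group (reflection a b ` \<Gamma>)"

definition Phi :: "nat \<Rightarrow> nat \<Rightarrow> root_space set \<Rightarrow> root_space set" where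
  "Phi a b \<Gamma> = {w \<gamma> | w \<gamma>. w \<in> W_sub a b \<Gamma> \<and> \<gamma> \<in> \<Gamma>}"

definition ambient_finite :: "nat \<Rightarrow> nat \<Rightarrow> bool" where
  "ambient_finite a b \<longleftrightarrow> a * b < 4"

definition ambient_affine_A1 :: "nat \<Rightarrow> nat \<Rightarrow> bool" where
  "ambient_affine_A1 a b \<longleftrightarrow> a = 2 \<and> b = 2"

definition ambient_affine_A22 :: "nat \<Rightarrow> nat \<Rightarrow> bool" where
  "ambient_affine_A22 a b \<longleftrightarrow> a = 4 \<and> b = 1"

definition ambient_hyperbolic :: "nat \<Rightarrow> nat \<Rightarrow> bool" where
  "ambient_hyperbolic a b \<longleftrightarrow> a * b > 4"

definition type_A1 :: "nat \<Rightarrow> nat \<Rightarrow> root_space set \<Rightarrow> bool" where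
  "type_A1 a b \<Phi> \<longleftrightarrow> (\<exists>\<beta> \<in> real_roots a b. \<Phi> = {\<beta>, - \<beta>})"

definition cartan_matrix :: "nat \<Rightarrow> nat \<Rightarrow> root_space \<Rightarrow> root_space \<Rightarrow> real^2^2" where
  "cartan_matrix a b \<beta>1 \<beta>2 =
     vector [vector [2 * form a b \<beta>1 \<beta>1 / form a b \<beta>1 \<beta>1, 2 * form a b \<beta>1 \<beta>2 / form a b \<beta>1 \<beta>1],
             vector [2 * form a b \<beta>2 \<beta>1 / form a b \<beta>2 \<beta>2, 2 * form a b \<beta>2 \<beta>2 / form a b \<beta>2 \<beta>2]]"

text \<open>
  Linear independence is part of being a basis and cannot be dropped: otherwise \<open>{\<beta>, - \<beta>}\<close>
  would itself be a ``basis'' of type \<open>H(2,2)\<close>.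
\<close>

definition is_simple_basis :: "nat \<Rightarrow> nat \<Rightarrow> root_space set \<Rightarrow> root_space \<Rightarrow> root_space \<Rightarrow> bool" where
  "is_simple_basis a b \<Phi> \<beta>1 \<beta>2 \<longleftrightarrow>
     {\<beta>1, \<beta>2} \<subseteq> \<Phi> \<and> \<beta>1 \<noteq> \<beta>2 \<and> independent {\<beta>1, \<beta>2} \<and>
     \<Phi> = Phi a b {\<beta>1, \<beta>2} \<and>
     (\<forall>\<gamma> \<in> \<Phi>. \<exists>k l :: nat.
        \<gamma> = real k *\<^sub>R \<beta>1 + real l *\<^sub>R \<beta>2 \<or> \<gamma> = - (real k *\<^sub>R \<beta>1 + real l *\<^sub>R \<beta>2))"

definition type_H :: "nat \<Rightarrow> nat \<Rightarrow> root_space set \<Rightarrow> nat \<Rightarrow> nat \<Rightarrow> bool" where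
  "type_H a b \<Phi> m n \<longleftrightarrow>
     m \<ge> 1 \<and> n \<ge> 1 \<and>
     (\<exists>\<beta>1 \<beta>2. is_simple_basis a b \<Phi> \<beta>1 \<beta>2 \<and> cartan_matrix a b \<beta>1 \<beta>2 = H m n)"

definition type_affine_A1 :: "nat \<Rightarrow> nat \<Rightarrow> root_space set \<Rightarrow> bool" where
  "type_affine_A1 a b \<Phi> \<longleftrightarrow> type_H a b \<Phi> 2 2"

definition type_affine_A22 :: "nat \<Rightarrow> nat \<Rightarrow> root_space set \<Rightarrow> bool" where
  "type_affine_A22 a b \<Phi> \<longleftrightarrow> type_H a b \<Phi> 4 1"

definition type_hyperbolic :: "nat \<Rightarrow> nat \<Rightarrow> root_space set \<Rightarrow> bool" where
  "type_hyperbolic a b \<Phi> \<longleftrightarrow> (\<exists>m n. m * n > 4 \<and> type_H a b \<Phi> m n)"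

lemma w1_eq_reflection: "a \<ge> 1 \<Longrightarrow> b \<ge> 1 \<Longrightarrow> w1 a b = reflection a b alpha1"
  by (auto simp: fun_eq_iff w1_def reflection_def form_def alpha1_def alpha2_def field_simps)

lemma w2_eq_reflection: "a \<ge> 1 \<Longrightarrow> b \<ge> 1 \<Longrightarrow> w2 a b = reflection a b alpha2"
  by (auto simp: fun_eq_iff w2_def reflection_def form_def alpha1_def alpha2_def field_simps)

lemma cartan_matrix_simple_roots:
  "a \<ge> 1 \<Longrightarrow> b \<ge> 1 \<Longrightarrow> cartan_matrix a b alpha1 alpha2 = H a b"
  by (simp add: cartan_matrix_def H_def form_def alpha1_def alpha2_def field_simps)

lemma BijGroup_UNIV_mult:
  "bij f \<Longrightarrow> bij g \<Longrightarrow> f \<otimes>\<^bsub>BijGroup UNIV\<^esub> g = f \<circ> g"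
  by (auto simp: BijGroup_def Bij_def compose_def fun_eq_iff)

end

theory Submission
  imports Defs
begin

text \<open>
  Put \<open>p\<^sub>0 = - \<alpha>\<^sub>1\<close>, \<open>p\<^sub>1 = \<alpha>\<^sub>2\<close> and continue in both directions by
  \<open>p\<^bsub>k+1\<^esub> + p\<^bsub>k-1\<^esub> = c\<^sub>k p\<^sub>k\<close>, where \<open>c\<^sub>k\<close> is \<open>b\<close> for even and \<open>a\<close> for odd \<open>k\<close>. Every real
  root is \<open>\<plusminus> p\<^sub>k\<close> for some integer \<open>k\<close>, and the reflection in \<open>p\<^sub>k\<close> sends \<open>p\<^sub>j\<close> to \<open>- p\<^bsub>2k-j\<^esub>\<close>
  (\<open>reflection_root_chain\<close>): up to sign, the Weyl group acts on indices through the
  reflections of the integers. This turns questions about root subsystems into questions about subsets of \<open>\<int>\<close>.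

  Let \<open>ab \<ge> 4\<close>. Since \<open>\<Phi>(\<Gamma>)\<close> is stable under the reflections in all of its own elements
  (\<open>Phi_reflection_closed\<close>), its index set \<open>J\<close> is stable under \<open>j \<mapsto> 2k - j\<close> for \<open>k \<in> J\<close>. Two elements of
  \<open>J\<close> at minimal distance \<open>d\<close> then generate all of it, so \<open>J\<close> is a single index, which gives type
  \<open>A\<^sub>1\<close>, or a progression \<open>j + d\<int>\<close> (\<open>reflection_closed_int_set\<close>).

  In the second case the sequence \<open>q\<^sub>i = p\<^bsub>j+di\<^esub>\<close> satisfies a recurrence of the same shape, whose two
  coefficients \<open>n\<close> and \<open>m\<close> are the Cartan numbers of \<open>\<beta>\<^sub>1 = - p\<^sub>j\<close> and \<open>\<beta>\<^sub>2 = p\<^bsub>j+d\<^esub>\<close> up to sign. Hence the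
  coordinates of \<open>q\<^sub>i\<close> with respect to \<open>\<beta>\<^sub>1, \<beta>\<^sub>2\<close> are those of the \<open>i\<close>-th member of the chain of
  \<open>H(m,n)\<close>. A root subsystem is thus a copy of a full rank 2 root system, and the sign condition on
  a simple basis is the familiar fact that a root is positive or negative
  (\<open>type_H_root_chain_progression\<close>).

  Which \<open>m\<close> and \<open>n\<close> can occur is governed by the Gram determinant of \<open>p\<^sub>j\<close> and \<open>p\<^bsub>j+d\<^esub>\<close>: it yields
  \<open>mn - 4 = C (ab - 4)\<close> with \<open>C > 0\<close> (\<open>cartan_number_product\<close>), so affine systems have only affine rank 2
  subsystems and hyperbolic systems only hyperbolic ones. If \<open>mn = 4\<close>, then \<open>(m,n)\<close> is \<open>(2,2)\<close>, \<open>(4,1)\<close>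
  or \<open>(1,4)\<close>; the last two differ by the order of the basis and are impossible when all roots have
  the same length, that is for \<open>a = b\<close>.

  For \<open>ab < 4\<close> the form is positive definite, and the roots are integral vectors of bounded norm.
\<close>

section \<open>Two-sided sequences with an alternating three-term recurrence\<close>

definition alternating :: "real \<Rightarrow> real \<Rightarrow> (int \<Rightarrow> 'a::real_vector) \<Rightarrow> bool" where
  "alternating c c' f \<longleftrightarrow> (\<forall>k. f (k + 1) + f (k - 1) = (if even k then c else c') *\<^sub>R f k)"

lemma alternating_next:
  "alternating c c' f \<Longrightarrow> f (k + 2) = (if even k then c' else c) *\<^sub>R f (k + 1) - f k"
  unfolding alternating_def by (drule spec[of _ "k + 1"]) (auto simp: algebra_simps)

lemma alternating_prev:
  "alternating c c' f \<Longrightarrow> f k = (if even k then c' else c) *\<^sub>R f (k + 1) - f (k + 2)"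
  unfolding alternating_def by (drule spec[of _ "k + 1"]) (auto simp: algebra_simps)

lemma int_two_step_induct:
  fixes k j :: int
  assumes base: "P k" "P (k + 1)"
    and up: "\<And>i. P i \<Longrightarrow> P (i + 1) \<Longrightarrow> P (i + 2)"
    and down: "\<And>i. P (i + 1) \<Longrightarrow> P (i + 2) \<Longrightarrow> P i"
  shows "P j"
proof -
  have "P j \<and> P (j + 1)"
  proof (induction j rule: int_induct[where k = k])
    case base
    then show ?case using assms(1,2) by simp
  next
    case (step1 i)
    then show ?case using up[of i] by (simp add: algebra_simps)
  next
    case (step2 i)
    then show ?case using down[of "i - 1"] by (simp add: algebra_simps)
  qed
  then show ?thesis by simp
qed

text \<open>
  Identities between sequences built from roots reduce to this: once both sides are known to satisfy
  the recurrence, two consecutive values decide.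
\<close>

lemma alternating_unique:
  assumes f: "alternating c c' f" and g: "alternating c c' g"
    and "f k = g k" "f (k + 1) = g (k + 1)"
  shows "f j = g j"
proof (rule int_two_step_induct[of "\<lambda>j. f j = g j" k])
  show "f (i + 2) = g (i + 2)" if "f i = g i" "f (i + 1) = g (i + 1)" for i
    using that alternating_next[OF f, of i] alternating_next[OF g, of i] by simp
  show "f i = g i" if "f (i + 1) = g (i + 1)" "f (i + 2) = g (i + 2)" for i
    using that alternating_prev[OF f, of i] alternating_prev[OF g, of i] by simp
qed (use assms in auto)

lemma alternating_linear:
  assumes "linear T" "alternating c c' f"
  shows "alternating c c' (\<lambda>k. T (f k))"
  using assms unfolding alternating_def
  by (auto simp flip: linear_add linear_scale)

lemma alternating_shift:
  "alternating c c' f \<Longrightarrow>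
   alternating (if even j then c else c') (if even j then c' else c) (\<lambda>k. f (j + k))"
  unfolding alternating_def
  by (intro allI, drule_tac x = "j + k" in spec) (auto simp: algebra_simps)

lemma alternating_reverse: "alternating c c' f \<Longrightarrow> alternating c c' (\<lambda>k. f (- k))"
  unfolding alternating_def
  by (intro allI, drule_tac x = "- k" in spec) (auto simp: algebra_simps)

lemma alternating_Ints:
  fixes f :: "int \<Rightarrow> real"
  assumes f: "alternating c c' f" and c: "c \<in> \<int>" "c' \<in> \<int>" and "f k \<in> \<int>" "f (k + 1) \<in> \<int>"
  shows "f j \<in> \<int>"
proof (rule int_two_step_induct[of "\<lambda>j. f j \<in> \<int>" k])
  show "f (i + 2) \<in> \<int>" if "f i \<in> \<int>" "f (i + 1) \<in> \<int>" for i
    using that c alternating_next[OF f, of i] by auto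
  show "f i \<in> \<int>" if "f (i + 1) \<in> \<int>" "f (i + 2) \<in> \<int>" for i
    using that c alternating_prev[OF f, of i] by auto
qed (use assms in auto)

text \<open>
  For \<open>c c' \<ge> 4\<close> the recurrence is convex enough to keep a sequence growing. The invariant
  \<open>e\<^sub>i f\<^sub>i \<ge> 2 f\<^bsub>i-1\<^esub>\<close>, with \<open>e\<^sub>i\<close> the current coefficient, gives \<open>f\<^bsub>i+1\<^esub> = e\<^sub>i f\<^sub>i - f\<^bsub>i-1\<^esub> \<ge> e\<^sub>i f\<^sub>i / 2\<close>, and
  \<open>e\<^bsub>i+1\<^esub> e\<^sub>i \<ge> 4\<close> reproduces it one step further.
\<close>

lemma alternating_pos:
  fixes f :: "int \<Rightarrow> real"
  assumes f: "alternating c c' f" and c: "c > 0" "c' > 0" "c * c' \<ge> 4"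
    and init: "f 0 \<ge> 0" "f 1 > 0" "c' * f 1 \<ge> 2 * f 0" and "i \<ge> 1"
  shows "f i > 0"
proof -
  define e where "e k = (if even k then c else c')" for k :: int
  have e: "e k > 0" "e (k + 1) * e k \<ge> 4" for k
    using c by (auto simp: e_def mult.commute)
  have rec: "f (k + 2) = e (k + 1) * f (k + 1) - f k" for k
    using alternating_next[OF f, of k] by (auto simp: e_def)
  have "f i > 0 \<and> e i * f i \<ge> 2 * f (i - 1)"
    using \<open>i \<ge> 1\<close>
  proof (induction i rule: int_ge_induct)
    case base
    then show ?case using init by (simp add: e_def)
  next
    case (step i)
    have half: "2 * f (i + 1) \<ge> e i * f i"
      using step rec[of "i - 1"] by (simp add: algebra_simps)
    moreover have "e i * f i > 0"
      using step e by simp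
    ultimately have pos: "f (i + 1) > 0"
      by linarith
    have "2 * (e (i + 1) * f (i + 1)) \<ge> e (i + 1) * (e i * f i)"
      using mult_left_mono[OF half, of "e (i + 1)"] e(1)[of "i + 1"] by (simp add: algebra_simps)
    moreover have "e (i + 1) * e i * f i \<ge> 4 * f i"
      using e(2)[of i] step by (intro mult_right_mono) auto
    ultimately show ?case
      using pos by (simp add: algebra_simps)
  qed
  then show ?thesis by simp
qed

section \<open>The chain of real roots\<close>

text \<open>
  The coefficients depend only on the parity of the index, so the negative half of a two-sided
  solution is again a forward recursion, started at the values at \<open>0\<close> and \<open>- 1\<close>.
\<close>

fun half_chain :: "nat \<Rightarrow> nat \<Rightarrow> root_space \<Rightarrow> root_space \<Rightarrow> nat \<Rightarrow> root_space" where
  "half_chain a b u v 0 = u"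
| "half_chain a b u v (Suc 0) = v"
| "half_chain a b u v (Suc (Suc k)) =
     (if even k then real a else real b) *\<^sub>R half_chain a b u v (Suc k) - half_chain a b u v k"

definition root_chain :: "nat \<Rightarrow> nat \<Rightarrow> int \<Rightarrow> root_space" where
  "root_chain a b k =
     (if k \<ge> 0 then half_chain a b (- alpha1) alpha2 (nat k)
      else half_chain a b (- alpha1) (- (real b *\<^sub>R alpha1) - alpha2) (nat (- k)))"

lemma root_chain_0: "root_chain a b 0 = (- 1, 0)"
  and root_chain_1: "root_chain a b 1 = (0, 1)"
  by (simp_all add: root_chain_def alpha1_def alpha2_def)

lemma root_chain_alternating: "alternating (real b) (real a) (root_chain a b)"
  unfolding alternating_def
proof
  fix k :: int
  consider "k = 0" | n where "k = int (Suc n)" | n where "k = - int (Suc n)"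
    by (metis int_cases2 nat.exhaust of_nat_0 add.inverse_neutral)
  then show "root_chain a b (k + 1) + root_chain a b (k - 1) =
      (if even k then real b else real a) *\<^sub>R root_chain a b k"
  proof cases
    case 1
    then show ?thesis by (simp add: root_chain_def)
  next
    case 2
    have "nat (k + 1) = Suc (Suc n)" "nat (k - 1) = n" "nat k = Suc n" using 2 by auto
    then show ?thesis using 2 by (simp add: root_chain_def)
  next
    case 3
    have "nat (- (k - 1)) = Suc (Suc n)" "nat (- (k + 1)) = n" "nat (- k) = Suc n" using 3 by auto
    then show ?thesis using 3 by (cases "n = 0") (auto simp: root_chain_def numeral_2_eq_2)
  qed
qed

lemma root_chain_next:
  "root_chain a b (k + 2) = (if even k then real a else real b) *\<^sub>R root_chain a b (k + 1) - root_chain a b k"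
  by (rule alternating_next[OF root_chain_alternating])

lemma root_chain_prev:
  "root_chain a b (k - 1) = (if even k then real b else real a) *\<^sub>R root_chain a b k - root_chain a b (k + 1)"
  using alternating_prev[OF root_chain_alternating, of a b "k - 1"] by (simp add: add.commute[of 1])

lemma root_chain_Ints: "fst (root_chain a b k) \<in> \<int>" "snd (root_chain a b k) \<in> \<int>"
  by (rule alternating_Ints[OF alternating_linear[OF _ root_chain_alternating], where k = 0];
      simp add: linear_fst linear_snd root_chain_0 root_chain_1)+

text \<open>
  Each coordinate of the chain is a scalar solution with starting values \<open>0, 1\<close> at a suitable place;
  the first coordinate vanishes at index \<open>1\<close>, the second at index \<open>0\<close>, and growth sets in from
  there in both directions.
\<close>

lemma root_chain_pos:
  assumes "a * b \<ge> 4" "k \<ge> 1"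
  shows "fst (root_chain a b k) \<ge> 0" "snd (root_chain a b k) > 0"
proof -
  have pos: "real a > 0" "real b > 0" "real a * real b \<ge> 4" "real b * real a \<ge> 4"
    using assms(1) by (auto simp: mult.commute intro!: gr0I simp flip: of_nat_mult)
  show "snd (root_chain a b k) > 0"
    by (rule alternating_pos[OF alternating_linear[OF linear_snd root_chain_alternating, of b a]])
      (use assms pos in \<open>auto simp: root_chain_0 root_chain_1\<close>)
  have "alternating (real a) (real b) (\<lambda>i. fst (root_chain a b (1 + i)))"
    using alternating_shift[OF root_chain_alternating, of 1 b a]
    by (intro alternating_linear[OF linear_fst]) simp
  then have "fst (root_chain a b (1 + i)) > 0" if "i \<ge> 1" for i
    by (rule alternating_pos)
      (use that pos in \<open>auto simp: root_chain_0 root_chain_1 root_chain_next[of a b 0, simplified]\<close>)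
  from this[of "k - 1"] show "fst (root_chain a b k) \<ge> 0"
    using assms(2) by (cases "k = 1") (auto simp: root_chain_1)
qed

lemma root_chain_neg:
  assumes "a * b \<ge> 4" "k \<le> 0"
  shows "fst (root_chain a b k) < 0" "snd (root_chain a b k) \<le> 0"
proof -
  have pos: "real a > 0" "real b > 0" "real a * real b \<ge> 4" "real b * real a \<ge> 4"
    using assms(1) by (auto simp: mult.commute intro!: gr0I simp flip: of_nat_mult)
  have rev: "alternating (real b) (real a) (\<lambda>i. root_chain a b (- i))"
    by (rule alternating_reverse[OF root_chain_alternating])
  have "alternating (real b) (real a) (\<lambda>i. - snd (root_chain a b (- i)))"
    by (rule alternating_linear[OF _ rev]) (intro linear_compose_neg linear_snd)
  then have "- snd (root_chain a b (- i)) > 0" if "i \<ge> 1" for i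
    by (rule alternating_pos)
      (use that pos in \<open>auto simp: root_chain_0 root_chain_1 root_chain_prev[of a b 0, simplified]\<close>)
  from this[of "- k"] show "snd (root_chain a b k) \<le> 0"
    using assms(2) by (cases "k = 0") (auto simp: root_chain_0)
  have "alternating (real a) (real b) (\<lambda>i. root_chain a b (1 - i))"
    using alternating_shift[OF rev, of "- 1"] by simp
  then have "alternating (real a) (real b) (\<lambda>i. - fst (root_chain a b (1 - i)))"
    by (rule alternating_linear[rotated]) (intro linear_compose_neg linear_fst)
  then have "- fst (root_chain a b (1 - i)) > 0" if "i \<ge> 1" for i
    by (rule alternating_pos) (use that pos in \<open>auto simp: root_chain_0 root_chain_1\<close>)
  from this[of "1 - k"] show "fst (root_chain a b k) < 0"
    using assms(2) by simp
qed

section \<open>Form and reflections\<close>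

lemma form_commute: "form a b u v = form a b v u"
  by (simp add: form_def algebra_simps)

lemma form_simps:
  "form a b (u + v) w = form a b u w + form a b v w"
  "form a b w (u + v) = form a b w u + form a b w v"
  "form a b (u - v) w = form a b u w - form a b v w"
  "form a b w (u - v) = form a b w u - form a b w v"
  "form a b (- u) w = - form a b u w"
  "form a b w (- u) = - form a b w u"
  "form a b (r *\<^sub>R u) w = r * form a b u w"
  "form a b w (r *\<^sub>R u) = r * form a b w u"
  by (simp_all add: form_def algebra_simps)

lemma linear_reflection: "linear (reflection a b \<alpha>)"
  by (rule linearI) (simp_all add: reflection_def form_simps algebra_simps add_divide_distrib)

lemma reflection_uminus_root: "reflection a b (- \<alpha>) = reflection a b \<alpha>"
  by (simp add: fun_eq_iff reflection_def form_simps)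

lemma reflection_self: "form a b \<alpha> \<alpha> \<noteq> 0 \<Longrightarrow> reflection a b \<alpha> \<alpha> = - \<alpha>"
  by (simp add: reflection_def scaleR_2)

lemma reflection_involution:
  "form a b \<alpha> \<alpha> \<noteq> 0 \<Longrightarrow> reflection a b \<alpha> (reflection a b \<alpha> v) = v"
  by (simp add: reflection_def form_simps field_simps)

lemma reflection_isometry:
  "form a b \<alpha> \<alpha> \<noteq> 0 \<Longrightarrow> form a b (reflection a b \<alpha> u) (reflection a b \<alpha> v) = form a b u v"
  by (simp add: reflection_def form_simps form_commute[of a b \<alpha> u] form_commute[of a b \<alpha> v] field_simps)

lemma reflection_conjugate:
  assumes "form a b \<alpha> \<alpha> \<noteq> 0"
  shows "reflection a b (reflection a b \<alpha> \<gamma>) v =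
         reflection a b \<alpha> (reflection a b \<gamma> (reflection a b \<alpha> v))"
proof -
  have "form a b v (reflection a b \<alpha> \<gamma>) = form a b (reflection a b \<alpha> v) \<gamma>"
    using reflection_isometry[OF assms, of "reflection a b \<alpha> v" \<gamma>]
    by (simp add: reflection_involution[OF assms])
  moreover have "reflection a b \<alpha> (reflection a b \<gamma> (reflection a b \<alpha> v)) =
      v - (2 * form a b (reflection a b \<alpha> v) \<gamma> / form a b \<gamma> \<gamma>) *\<^sub>R reflection a b \<alpha> \<gamma>"
    unfolding reflection_def[of a b \<gamma>]
    by (simp add: linear_diff[OF linear_reflection] linear_scale[OF linear_reflection]
        reflection_involution[OF assms])
  ultimately show ?thesis
    by (simp add: reflection_def[of a b "reflection a b \<alpha> \<gamma>"] reflection_isometry[OF assms])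
qed

text \<open>
  The three values in the induction determine the Gram matrix of two consecutive members, and the
  recurrence carries it along because \<open>c\<^sub>k (p\<^sub>k, p\<^sub>k) = 2a\<close> for both parities.
\<close>

lemma form_root_chain:
  assumes "b \<ge> 1"
  shows "form a b (root_chain a b k) (root_chain a b k) = (if even k then 2 * real a / real b else 2)"
    and "form a b (root_chain a b k) (root_chain a b (k + 1)) = real a"
proof -
  define N where "N k = (if even k then 2 * real a / real b else 2)" for k :: int
  define e where "e k = (if even k then real b else real a)" for k :: int
  let ?p = "root_chain a b"
  have eN: "e k * N k = 2 * real a" "N (k + 2) = N k" "N (k - 1) = N (k + 1)" for k
    using assms by (auto simp: e_def N_def)
  have up: "?p (k + 2) = e (k + 1) *\<^sub>R ?p (k + 1) - ?p k"
    and down: "?p (k - 1) = e k *\<^sub>R ?p k - ?p (k + 1)" for k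
    by (auto simp: e_def root_chain_next root_chain_prev)
  have "form a b (?p k) (?p k) = N k \<and> form a b (?p (k + 1)) (?p (k + 1)) = N (k + 1) \<and>
        form a b (?p k) (?p (k + 1)) = real a"
  proof (induction k rule: int_induct[where k = 0])
    case base
    then show ?case
      by (simp add: root_chain_0 root_chain_1 form_def N_def)
  next
    case (step1 i)
    have flip: "form a b (?p (i + 1)) (?p i) = real a"
      using step1 by (simp add: form_commute)
    have "form a b (?p (i + 2)) (?p (i + 2)) =
        e (i + 1) * (e (i + 1) * N (i + 1)) - 2 * e (i + 1) * real a + N i"
      using step1 unfolding up by (simp add: form_simps flip flip[unfolded add.commute[of i 1]] algebra_simps)
    moreover have "form a b (?p (i + 1)) (?p (i + 2)) = e (i + 1) * N (i + 1) - real a"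
      using step1 unfolding up by (simp add: form_simps flip flip[unfolded add.commute[of i 1]] algebra_simps)
    ultimately show ?case
      using step1 by (simp add: eN add.commute[of 2])
  next
    case (step2 i)
    have flip: "form a b (?p (i + 1)) (?p i) = real a"
      using step2 by (simp add: form_commute)
    have "form a b (?p (i - 1)) (?p (i - 1)) =
        e i * (e i * N i) - 2 * e i * real a + N (i + 1)"
      using step2 unfolding down by (simp add: form_simps flip flip[unfolded add.commute[of i 1]] algebra_simps)
    moreover have "form a b (?p (i - 1)) (?p i) = e i * N i - real a"
      using step2 unfolding down by (simp add: form_simps flip flip[unfolded add.commute[of i 1]] algebra_simps)
    ultimately show ?case
      using step2 by (simp add: eN add.commute[of 2])
  qed
  then show "form a b (?p k) (?p k) = (if even k then 2 * real a / real b else 2)"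
    and "form a b (?p k) (?p (k + 1)) = real a"
    by (auto simp: N_def)
qed

lemma form_root_chain_pos:
  assumes "a \<ge> 1" "b \<ge> 1"
  shows "form a b (root_chain a b k) (root_chain a b k) > 0"
  using assms by (simp add: form_root_chain)

text \<open>
  Both sides solve the recurrence in \<open>j\<close>, because \<open>j \<mapsto> 2k - j\<close> preserves parity; they agree at
  \<open>j = k\<close> and, by the recurrence at \<open>k\<close>, at \<open>j = k + 1\<close>.
\<close>

lemma reflection_root_chain:
  assumes "a \<ge> 1" "b \<ge> 1"
  shows "reflection a b (root_chain a b k) (root_chain a b j) = - root_chain a b (2 * k - j)"
proof (rule alternating_unique[of "real b" "real a" _ "\<lambda>j. - root_chain a b (2 * k - j)" k])
  let ?p = "root_chain a b"
  show "alternating (real b) (real a) (\<lambda>j. reflection a b (?p k) (?p j))"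
    by (rule alternating_linear[OF linear_reflection root_chain_alternating])
  have "alternating (real b) (real a) (\<lambda>j. ?p (2 * k - j))"
    using alternating_shift[OF alternating_reverse[OF root_chain_alternating], of "- (2 * k)"] by simp
  then show "alternating (real b) (real a) (\<lambda>j. - ?p (2 * k - j))"
    using alternating_linear[OF linear_uminus] by blast
  show "reflection a b (?p k) (?p k) = - ?p (2 * k - k)"
    using form_root_chain_pos[OF assms, of k] by (simp add: reflection_self)
  have "reflection a b (?p k) (?p (k + 1)) = ?p (k + 1) - (if even k then real b else real a) *\<^sub>R ?p k"
    using assms form_root_chain[OF assms(2), of a k] form_commute[of a b "?p (k + 1)" "?p k"]
    by (simp add: reflection_def)
  then show "reflection a b (?p k) (?p (k + 1)) = - ?p (2 * k - (k + 1))"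
    using root_chain_prev[of a b k] by simp
qed

section \<open>Groups generated by involutions\<close>

lemma BijGroup_UNIV: "carrier (BijGroup UNIV) = {f. bij f}" "\<one>\<^bsub>BijGroup UNIV\<^esub> = (\<lambda>x. x)"
  by (auto simp: BijGroup_def Bij_def)

text \<open>
  Involutions are their own inverses, so a set that is mapped into itself by the generators is mapped
  into itself by the whole group.
\<close>

lemma generated_group_induct:
  assumes w: "w \<in> generated_group S"
    and inv: "\<And>s x. s \<in> S \<Longrightarrow> s (s x) = x"
    and closed: "\<And>s x. s \<in> S \<Longrightarrow> x \<in> X \<Longrightarrow> s x \<in> X"
    and "x \<in> X"
  shows "w x \<in> X"
proof -
  have S: "S \<subseteq> carrier (BijGroup UNIV)"
    using inv by (auto simp: BijGroup_UNIV intro: involuntory_imp_bij)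
  have "\<forall>x \<in> X. w x \<in> X"
    using w unfolding generated_group_def
  proof (induction w rule: generate.induct)
    case one
    then show ?case by (simp add: BijGroup_UNIV)
  next
    case (incl h)
    then show ?case using closed by blast
  next
    case (inv h)
    have "h \<otimes>\<^bsub>BijGroup UNIV\<^esub> h = \<one>\<^bsub>BijGroup UNIV\<^esub>"
      using inv S assms(2) by (auto simp: BijGroup_UNIV BijGroup_UNIV_mult fun_eq_iff)
    then have "inv\<^bsub>BijGroup UNIV\<^esub> h = h"
      using inv S by (intro group.inv_equality[OF group_BijGroup]) auto
    then show ?case using closed inv by auto
  next
    case (eng h1 h2)
    then have "h1 \<in> carrier (BijGroup UNIV)" "h2 \<in> carrier (BijGroup UNIV)"
      using group.generate_in_carrier[OF group_BijGroup S] by blast+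
    then show ?case
      using eng by (auto simp: BijGroup_UNIV BijGroup_UNIV_mult)
  qed
  then show ?thesis using \<open>x \<in> X\<close> by blast
qed

lemma Phi_subset:
  assumes "\<And>\<gamma>. \<gamma> \<in> \<Gamma> \<Longrightarrow> form a b \<gamma> \<gamma> \<noteq> 0" "\<Gamma> \<subseteq> X"
    and "\<And>\<gamma> x. \<gamma> \<in> \<Gamma> \<Longrightarrow> x \<in> X \<Longrightarrow> reflection a b \<gamma> x \<in> X"
  shows "Phi a b \<Gamma> \<subseteq> X"
proof
  fix x assume "x \<in> Phi a b \<Gamma>"
  then obtain w \<gamma> where w: "w \<in> generated_group (reflection a b ` \<Gamma>)" "\<gamma> \<in> \<Gamma>" "x = w \<gamma>"
    by (auto simp: Phi_def W_sub_def)
  show "x \<in> X"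
    unfolding w(3) using w(1)
  proof (rule generated_group_induct)
    show "\<gamma> \<in> X" using w(2) assms(2) by blast
  qed (use assms(1,3) reflection_involution in blast)+
qed

lemma subset_Phi: "\<Gamma> \<subseteq> Phi a b \<Gamma>"
proof
  fix x assume "x \<in> \<Gamma>"
  moreover have "(\<lambda>v. v) \<in> W_sub a b \<Gamma>"
    using generate.one[of "BijGroup UNIV" "reflection a b ` \<Gamma>"]
    by (simp add: W_sub_def generated_group_def BijGroup_UNIV)
  ultimately show "x \<in> Phi a b \<Gamma>"
    unfolding Phi_def mem_Collect_eq by (intro exI[of _ "\<lambda>v. v"] exI[of _ x]) simp
qed

lemma Phi_simple_reflection_closed:
  assumes \<Gamma>: "\<And>\<gamma>. \<gamma> \<in> \<Gamma> \<Longrightarrow> form a b \<gamma> \<gamma> \<noteq> 0" and "\<gamma> \<in> \<Gamma>" "x \<in> Phi a b \<Gamma>"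
  shows "reflection a b \<gamma> x \<in> Phi a b \<Gamma>"
proof -
  let ?G = "BijGroup (UNIV :: root_space set)"
  obtain w \<delta> where w: "w \<in> W_sub a b \<Gamma>" "\<delta> \<in> \<Gamma>" "x = w \<delta>"
    using assms(3) unfolding Phi_def by blast
  have sub: "reflection a b ` \<Gamma> \<subseteq> carrier ?G"
    using \<Gamma> reflection_involution unfolding BijGroup_UNIV by (blast intro: involuntory_imp_bij)
  then have "w \<in> carrier ?G" "reflection a b \<gamma> \<in> carrier ?G"
    using w assms(2) group.generate_in_carrier[OF group_BijGroup sub]
    by (auto simp: W_sub_def generated_group_def)
  moreover have "reflection a b \<gamma> \<otimes>\<^bsub>?G\<^esub> w \<in> W_sub a b \<Gamma>"
    using w assms(2) by (auto simp: W_sub_def generated_group_def intro: generate.intros)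
  ultimately have "(\<lambda>v. reflection a b \<gamma> (w v)) \<in> W_sub a b \<Gamma>"
    by (simp add: BijGroup_UNIV BijGroup_UNIV_mult comp_def)
  then show ?thesis
    unfolding Phi_def mem_Collect_eq w(3) using w(2) by (intro exI conjI) auto
qed

text \<open>
  The reflection in \<open>w \<gamma>\<close> is the conjugate of the reflection in \<open>\<gamma>\<close> by \<open>w\<close>. In terms of sets: the
  vectors whose reflection preserves \<open>\<Phi>(\<Gamma>)\<close> contain \<open>\<Gamma>\<close> and are permuted by its reflections.
\<close>

lemma Phi_reflection_closed:
  assumes "\<And>\<gamma>. \<gamma> \<in> \<Gamma> \<Longrightarrow> form a b \<gamma> \<gamma> \<noteq> 0" "\<gamma> \<in> Phi a b \<Gamma>" "x \<in> Phi a b \<Gamma>"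
  shows "reflection a b \<gamma> x \<in> Phi a b \<Gamma>"
proof -
  define X where "X = {\<gamma>. form a b \<gamma> \<gamma> \<noteq> 0 \<and> (\<forall>x \<in> Phi a b \<Gamma>. reflection a b \<gamma> x \<in> Phi a b \<Gamma>)}"
  have "Phi a b \<Gamma> \<subseteq> X"
  proof (rule Phi_subset)
    show "\<Gamma> \<subseteq> X"
      using assms(1) Phi_simple_reflection_closed[OF assms(1)] unfolding X_def by blast
    fix \<gamma> \<delta> assume \<gamma>: "\<gamma> \<in> \<Gamma>" and \<delta>: "\<delta> \<in> X"
    have nz: "form a b \<gamma> \<gamma> \<noteq> 0"
      using \<gamma> by (rule assms(1))
    have "reflection a b (reflection a b \<gamma> \<delta>) x \<in> Phi a b \<Gamma>" if "x \<in> Phi a b \<Gamma>" for x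
      unfolding reflection_conjugate[OF nz]
      using that \<delta> Phi_simple_reflection_closed[OF assms(1) \<gamma>] unfolding X_def by blast
    then show "reflection a b \<gamma> \<delta> \<in> X"
      using \<delta> unfolding X_def mem_Collect_eq reflection_isometry[OF nz] by blast
  qed (rule assms(1))
  then show ?thesis
    using assms(2,3) unfolding X_def by blast
qed

section \<open>Index sets of root subsystems\<close>

text \<open>
  Root subsystems are symmetric under \<open>v \<mapsto> - v\<close>, so they can be recorded by sets of chain indices.
\<close>

definition signed_chain :: "nat \<Rightarrow> nat \<Rightarrow> int set \<Rightarrow> root_space set" where
  "signed_chain a b J = {v. \<exists>j \<in> J. v = root_chain a b j \<or> v = - root_chain a b j}"

lemma signed_chain_form_pos:
  assumes "a \<ge> 1" "b \<ge> 1" "v \<in> signed_chain a b J"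
  shows "form a b v v > 0"
  using assms form_root_chain_pos[OF assms(1,2)] by (auto simp: signed_chain_def form_simps)

lemma signed_chain_reflection_closed:
  assumes "a \<ge> 1" "b \<ge> 1" "u \<in> signed_chain a b K" "v \<in> signed_chain a b J"
    and "\<And>k j. k \<in> K \<Longrightarrow> j \<in> J \<Longrightarrow> 2 * k - j \<in> J"
  shows "reflection a b u v \<in> signed_chain a b J"
proof -
  obtain k where k: "k \<in> K" "reflection a b u = reflection a b (root_chain a b k)"
    using assms(3) by (auto simp: signed_chain_def reflection_uminus_root)
  obtain j where j: "j \<in> J" "v = root_chain a b j \<or> v = - root_chain a b j"
    using assms(4) by (auto simp: signed_chain_def)
  have "2 * k - j \<in> J"
    using assms(5) k j by blast
  then show ?thesis
    using j(2) unfolding k(2) signed_chain_def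
    by (auto simp: reflection_root_chain[OF assms(1,2)] linear_neg[OF linear_reflection])
qed

lemma real_roots_subset_chain:
  assumes "a \<ge> 1" "b \<ge> 1"
  shows "real_roots a b \<subseteq> signed_chain a b UNIV"
proof -
  have 1: "- alpha1 = root_chain a b 0" "alpha2 = root_chain a b 1"
    by (simp_all add: root_chain_0 root_chain_1 alpha1_def alpha2_def)
  then have mem: "alpha1 \<in> signed_chain a b UNIV" "alpha2 \<in> signed_chain a b UNIV"
    unfolding signed_chain_def by (metis (mono_tags, lifting) UNIV_I mem_Collect_eq minus_minus)+
  have "w v \<in> signed_chain a b UNIV" if "w \<in> weyl_group a b" "v \<in> signed_chain a b UNIV" for w v
    using that(1) unfolding weyl_group_def
  proof (rule generated_group_induct)
    show "v \<in> signed_chain a b UNIV" by fact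
    fix s x assume "s \<in> {w1 a b, w2 a b}"
    then obtain u where u: "s = reflection a b u" "u \<in> signed_chain a b UNIV"
      using mem w1_eq_reflection w2_eq_reflection assms by blast
    show "s (s x) = x"
      using signed_chain_form_pos[OF assms u(2)] by (simp add: u(1) reflection_involution)
    show "s x \<in> signed_chain a b UNIV" if "x \<in> signed_chain a b UNIV"
      unfolding u(1) using u(2) that by (rule signed_chain_reflection_closed[OF assms]) simp
  qed
  then show ?thesis
    using mem unfolding real_roots_def by blast
qed

lemma Phi_eq_signed_chain:
  assumes ab: "a \<ge> 1" "b \<ge> 1" and \<Gamma>: "\<Gamma> \<subseteq> signed_chain a b UNIV"
  obtains J where "Phi a b \<Gamma> = signed_chain a b J"
    and "\<And>j. root_chain a b j \<in> Phi a b \<Gamma> \<longleftrightarrow> j \<in> J"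
    and "\<And>j k. j \<in> J \<Longrightarrow> k \<in> J \<Longrightarrow> 2 * k - j \<in> J"
proof -
  define J where "J = {j. root_chain a b j \<in> Phi a b \<Gamma>}"
  have nz: "form a b \<gamma> \<gamma> \<noteq> 0" if "\<gamma> \<in> \<Gamma>" for \<gamma>
    using that \<Gamma> signed_chain_form_pos[OF ab] by fastforce
  have sub: "Phi a b \<Gamma> \<subseteq> signed_chain a b UNIV"
    using nz \<Gamma> signed_chain_reflection_closed[OF ab] by (intro Phi_subset) blast+
  have neg: "- v \<in> Phi a b \<Gamma>" if "v \<in> Phi a b \<Gamma>" for v
    using Phi_reflection_closed[OF nz that that] signed_chain_form_pos[OF ab, of v] that sub
    by (metis less_irrefl reflection_self subsetD)
  show ?thesis
  proof
    show "Phi a b \<Gamma> = signed_chain a b J"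
    proof
      show "Phi a b \<Gamma> \<subseteq> signed_chain a b J"
      proof
        fix v assume v: "v \<in> Phi a b \<Gamma>"
        then obtain j where "v = root_chain a b j \<or> v = - root_chain a b j"
          using sub by (auto simp: signed_chain_def)
        then show "v \<in> signed_chain a b J"
          using v neg[OF v] unfolding signed_chain_def J_def by auto
      qed
      show "signed_chain a b J \<subseteq> Phi a b \<Gamma>"
        unfolding signed_chain_def J_def using neg by blast
    qed
    show "2 * k - j \<in> J" if "j \<in> J" "k \<in> J" for j k
    proof -
      have "reflection a b (root_chain a b k) (root_chain a b j) \<in> Phi a b \<Gamma>"
        using that by (intro Phi_reflection_closed nz) (simp_all add: J_def)
      then show ?thesis
        using neg by (fastforce simp: J_def reflection_root_chain[OF ab])
    qed
  qed (simp add: J_def)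
qed

lemma progression_subset:
  fixes j d i :: int
  assumes "\<And>j k. j \<in> J \<Longrightarrow> k \<in> J \<Longrightarrow> 2 * k - j \<in> J" "j \<in> J" "j + d \<in> J"
  shows "j + d * i \<in> J"
proof (rule int_two_step_induct[of "\<lambda>i. j + d * i \<in> J" 0])
  show "j + d * (i + 2) \<in> J" if "j + d * i \<in> J" "j + d * (i + 1) \<in> J" for i
    using assms(1)[OF that] by (simp add: algebra_simps)
  show "j + d * i \<in> J" if "j + d * (i + 1) \<in> J" "j + d * (i + 2) \<in> J" for i
    using assms(1)[OF that(2,1)] by (simp add: algebra_simps)
qed (use assms in simp_all)

text \<open>
  If \<open>j\<close> and \<open>j + d\<close> are elements of \<open>J\<close> at the least positive distance, the whole progression \<open>j + d\<int>\<close>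
  lies in \<open>J\<close>, and any further element would be closer than \<open>d\<close> to one of its terms.
\<close>

lemma reflection_closed_int_set:
  fixes J :: "int set"
  assumes closed: "\<And>j k. j \<in> J \<Longrightarrow> k \<in> J \<Longrightarrow> 2 * k - j \<in> J" and "J \<noteq> {}"
  shows "(\<exists>j. J = {j}) \<or> (\<exists>j d. d \<ge> 1 \<and> J = range (\<lambda>i. j + d * i))"
proof (cases "\<exists>j. J = {j}")
  case False
  define D where "D = {n::nat. n > 0 \<and> (\<exists>j. j \<in> J \<and> j + int n \<in> J)}"
  obtain x y where "x \<in> J" "y \<in> J" "x < y"
    using False \<open>J \<noteq> {}\<close> by (metis is_singletonI' is_singleton_def linorder_neqE)
  then have "nat (y - x) \<in> D"
    by (auto simp: D_def intro!: exI[of _ x])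
  then have least: "(LEAST n. n \<in> D) \<in> D" "\<And>n. n \<in> D \<Longrightarrow> (LEAST n. n \<in> D) \<le> n"
    by (auto intro: LeastI Least_le)
  define d where "d = int (LEAST n. n \<in> D)"
  obtain j where j: "d > 0" "j \<in> J" "j + d \<in> J"
    using least(1) by (auto simp: D_def d_def)
  have prog: "j + d * i \<in> J" for i
    using closed j(2,3) by (rule progression_subset)
  have "x \<in> range (\<lambda>i. j + d * i)" if "x \<in> J" for x
  proof -
    let ?i = "(x - j) div d" and ?r = "(x - j) mod d"
    have x: "x = j + d * ?i + ?r"
      using mult_div_mod_eq[of d "x - j"] by linarith
    have r: "0 \<le> ?r" "?r < d"
      using j(1) by simp_all
    have "?r = 0"
    proof (rule ccontr)
      assume "?r \<noteq> 0"
      then have "nat ?r \<in> D"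
        using prog[of ?i] that x r(1) unfolding D_def by (auto intro!: exI[of _ "j + d * ?i"])
      then show False
        using least(2)[of "nat ?r"] r by (simp add: d_def)
    qed
    then have "x = j + d * ?i"
      using x by linarith
    then show ?thesis by blast
  qed
  then have "J = range (\<lambda>i. j + d * i)"
    using prog by blast
  moreover have "d \<ge> 1"
    using j(1) by simp
  ultimately show ?thesis
    by blast
qed simp

section \<open>Cartan numbers between members of the chain\<close>

definition cartan_number :: "nat \<Rightarrow> nat \<Rightarrow> int \<Rightarrow> int \<Rightarrow> real" where
  "cartan_number a b k d =
     2 * form a b (root_chain a b (k + d)) (root_chain a b k) / form a b (root_chain a b k) (root_chain a b k)"

text \<open>
  Widening the step of the chain from \<open>1\<close> to \<open>d\<close> leaves the shape of the recurrence unchanged. This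
  is \<open>p\<^bsub>k+d\<^esub> \<mapsto> - p\<^bsub>k-d\<^esub>\<close> under the reflection in \<open>p\<^sub>k\<close>.
\<close>

lemma root_chain_step:
  assumes "a \<ge> 1" "b \<ge> 1"
  shows "root_chain a b (k + d) + root_chain a b (k - d) = cartan_number a b k d *\<^sub>R root_chain a b k"
proof -
  have "root_chain a b (k + d) - cartan_number a b k d *\<^sub>R root_chain a b k = - root_chain a b (k - d)"
    using reflection_root_chain[OF assms, of k "k + d"] by (simp add: reflection_def cartan_number_def)
  then show ?thesis
    by (simp add: algebra_simps eq_neg_iff_add_eq_0)
qed

lemma cartan_number_uminus:
  assumes "a \<ge> 1" "b \<ge> 1"
  shows "cartan_number a b k (- d) = cartan_number a b k d"
proof -
  have "root_chain a b k \<noteq> 0"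
    using form_root_chain_pos[OF assms, of k] by (auto simp: form_def)
  moreover have "root_chain a b (k + - d) + root_chain a b (k - - d) =
      root_chain a b (k + d) + root_chain a b (k - d)"
    by (simp add: add.commute)
  then have "cartan_number a b k (- d) *\<^sub>R root_chain a b k = cartan_number a b k d *\<^sub>R root_chain a b k"
    unfolding root_chain_step[OF assms] .
  ultimately show ?thesis
    using scaleR_cancel_right by blast
qed

lemma cartan_number_reversed:
  assumes "a \<ge> 1" "b \<ge> 1"
  shows "cartan_number a b (k + d) d =
    2 * form a b (root_chain a b k) (root_chain a b (k + d)) /
    form a b (root_chain a b (k + d)) (root_chain a b (k + d))"
  unfolding cartan_number_uminus[OF assms, of "k + d" d, symmetric] by (simp add: cartan_number_def)

text \<open>
  As a function of the distance, a Cartan number is a linear functional of the chain. So it solves the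
  recurrence itself, with starting values \<open>2\<close> and \<open>c\<^sub>k\<close>; integrality, positivity and dependence on the
  parity of \<open>k\<close> alone all follow from this.
\<close>

lemma cartan_number_alternating:
  "alternating (if even k then real b else real a) (if even k then real a else real b) (cartan_number a b k)"
proof -
  have "linear (\<lambda>v. 2 / form a b (root_chain a b k) (root_chain a b k) * form a b v (root_chain a b k))"
    by (rule linearI) (simp_all add: form_simps algebra_simps)
  from alternating_linear[OF this alternating_shift[OF root_chain_alternating]]
  show ?thesis
    by (simp add: cartan_number_def[abs_def])
qed

lemma cartan_number_0_1:
  assumes "a \<ge> 1" "b \<ge> 1"
  shows "cartan_number a b k 0 = 2" "cartan_number a b k 1 = (if even k then real b else real a)"
  using form_root_chain_pos[OF assms, of k] assms form_root_chain[OF assms(2), of a k]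
  by (simp_all add: cartan_number_def form_commute[of a b "root_chain a b (k + 1)" "root_chain a b k"])

lemma cartan_number_Ints:
  assumes "a \<ge> 1" "b \<ge> 1"
  shows "cartan_number a b k d \<in> \<int>"
  by (rule alternating_Ints[OF cartan_number_alternating, where k = 0])
    (simp_all add: cartan_number_0_1[OF assms])

lemma cartan_number_parity:
  assumes "a \<ge> 1" "b \<ge> 1" "even k = even l"
  shows "cartan_number a b k d = cartan_number a b l d"
proof (rule alternating_unique[OF cartan_number_alternating, where k = 0])
  show "alternating (if even k then real b else real a) (if even k then real a else real b) (cartan_number a b l)"
    using cartan_number_alternating[of l b a] assms(3) by simp
qed (use assms in \<open>simp_all add: cartan_number_0_1\<close>)

lemma cartan_number_pos:
  assumes "a * b \<ge> 4" "d \<ge> 1"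
  shows "cartan_number a b k d > 0"
proof -
  have ab: "a \<ge> 1" "b \<ge> 1"
    using assms(1) by (auto intro!: Suc_leI gr0I)
  have four: "real a * real b \<ge> 4"
    using assms(1) by (simp flip: of_nat_mult)
  show ?thesis
    by (rule alternating_pos[OF cartan_number_alternating _ _ _ _ _ _ assms(2)])
      (use ab four in \<open>auto simp: cartan_number_0_1[OF ab] mult.commute\<close>)
qed

text \<open>
  The determinant measures linear independence; for \<open>ab \<ge> 4\<close> its sign is that of
  \<open>l - k\<close>.
\<close>

definition chain_det :: "nat \<Rightarrow> nat \<Rightarrow> int \<Rightarrow> int \<Rightarrow> real" where
  "chain_det a b k l =
     fst (root_chain a b l) * snd (root_chain a b k) - fst (root_chain a b k) * snd (root_chain a b l)"

lemma chain_det_1: "chain_det a b k (k + 1) = 1"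
proof (induction k rule: int_induct[where k = 0])
  case base
  then show ?case by (simp add: chain_det_def root_chain_0 root_chain_1)
next
  case (step1 i)
  have following: "root_chain a b (i + 1 + 1) =
      (if even i then real a else real b) *\<^sub>R root_chain a b (i + 1) - root_chain a b i"
    using root_chain_next[of a b i] by (simp add: add.assoc)
  show ?case
    using step1 unfolding chain_det_def following by (simp add: algebra_simps)
next
  case (step2 i)
  then show ?case
    unfolding chain_det_def root_chain_prev by (simp add: algebra_simps)
qed

lemma chain_det_pos:
  assumes "a * b \<ge> 4" "d \<ge> 1"
  shows "chain_det a b k (k + d) > 0"
proof -
  have "linear (\<lambda>v. fst v * snd (root_chain a b k) - fst (root_chain a b k) * snd v)"
    by (rule linearI) (simp_all add: algebra_simps)
  from alternating_linear[OF this alternating_shift[OF root_chain_alternating]]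
  have "alternating (if even k then real b else real a) (if even k then real a else real b)
      (\<lambda>d. chain_det a b k (k + d))"
    by (simp add: chain_det_def)
  moreover have "real a > 0" "real b > 0" "real a * real b \<ge> 4"
    using assms(1) by (auto intro!: gr0I simp flip: of_nat_mult)
  moreover have "chain_det a b k (k + 0) = 0"
    by (simp add: chain_det_def)
  ultimately show ?thesis
    using alternating_pos[of _ _ "\<lambda>d. chain_det a b k (k + d)", OF _ _ _ _ _ _ _ assms(2)]
    by (auto simp: chain_det_1 mult.commute split: if_splits)
qed

text \<open>
  A Gram determinant is the determinant of the form, here \<open>(a/b)(4 - ab)\<close>, times the square of the
  determinant of the two vectors.
\<close>

lemma gram_identity:
  assumes "b \<ge> 1"
  shows "form a b u u * form a b v v - (form a b u v)\<^sup>2 =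
    real a / real b * (4 - real (a * b)) * (fst v * snd u - fst u * snd v)\<^sup>2"
proof -
  have "real b \<noteq> 0" using assms by simp
  then show ?thesis
    unfolding form_def by (simp add: field_simps) algebra
qed

text \<open>
  The product equals \<open>4 (p\<^sub>k, p\<^bsub>k+d\<^esub>)\<^sup>2\<close> divided by the two norms, and the Gram identity compares the
  square with the product of the norms.
\<close>

lemma cartan_number_product:
  assumes "a \<ge> 1" "b \<ge> 1"
  obtains c where "c > 0"
    "cartan_number a b k d * cartan_number a b (k + d) d =
      4 + c * (real (a * b) - 4) * (chain_det a b k (k + d))\<^sup>2"
proof
  let ?u = "root_chain a b k" and ?v = "root_chain a b (k + d)"
  have pos: "form a b ?u ?u > 0" "form a b ?v ?v > 0"
    using form_root_chain_pos[OF assms] by auto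
  let ?c = "4 * (real a / real b) / (form a b ?u ?u * form a b ?v ?v)"
  show "?c > 0" using assms pos by simp
  have "cartan_number a b k d * cartan_number a b (k + d) d =
      4 * (form a b ?u ?v)\<^sup>2 / (form a b ?u ?u * form a b ?v ?v)"
    unfolding cartan_number_reversed[OF assms]
    by (simp add: cartan_number_def form_commute[of a b ?v ?u] power2_eq_square)
  moreover have "4 * x = 4 * y + 4 * r * (t - 4) * D" if "y - x = r * (4 - t) * D" for x y r t D :: real
    using that by algebra
  from this[OF gram_identity[OF assms(2)]]
  have "4 * (form a b ?u ?v)\<^sup>2 = 4 * (form a b ?u ?u * form a b ?v ?v) +
      4 * (real a / real b) * (real (a * b) - 4) * (chain_det a b k (k + d))\<^sup>2"
    unfolding chain_det_def .
  ultimately show "cartan_number a b k d * cartan_number a b (k + d) d =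
      4 + ?c * (real (a * b) - 4) * (chain_det a b k (k + d))\<^sup>2"
    using pos by (simp add: add_divide_distrib)
qed

section \<open>Rank two subsystems\<close>

text \<open>
  The progression is a relabelled chain of the root system of \<open>H(m,n)\<close>: this yields the coordinates of
  all its members with respect to the basis \<open>- p\<^sub>j, p\<^bsub>j+d\<^esub>\<close>. The minus sign makes the Cartan entries
  negative, as for the simple roots \<open>\<alpha>\<^sub>1 = - p\<^sub>0\<close> and \<open>\<alpha>\<^sub>2 = p\<^sub>1\<close>.
\<close>

lemma type_H_root_chain_progression:
  assumes ab: "a * b \<ge> 4" and d: "d \<ge> 1" and \<Phi>: "\<Phi> = signed_chain a b (range (\<lambda>i. j + d * i))"
    and n: "real n = cartan_number a b j d" and m: "real m = cartan_number a b (j + d) d"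
  shows "type_H a b \<Phi> m n"
proof -
  let ?p = "root_chain a b"
  define \<beta>1 where "\<beta>1 = - ?p j"
  define \<beta>2 where "\<beta>2 = ?p (j + d)"
  have ab1: "a \<ge> 1" "b \<ge> 1"
    using ab by (auto intro!: Suc_leI gr0I)
  have pos: "form a b \<beta>1 \<beta>1 > 0" "form a b \<beta>2 \<beta>2 > 0"
    using form_root_chain_pos[OF ab1] by (simp_all add: \<beta>1_def \<beta>2_def form_simps)
  have mn1: "m \<ge> 1" "n \<ge> 1"
    using cartan_number_pos[OF ab d, of j] cartan_number_pos[OF ab d, of "j + d"] n m by auto
  obtain c where c: "c > 0" "real (m * n) = 4 + c * (real (a * b) - 4) * (chain_det a b j (j + d))\<^sup>2"
    using cartan_number_product[OF ab1, of j d] n m by (metis mult.commute of_nat_mult)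
  have "real (a * b) - 4 \<ge> 0"
    using ab by (simp flip: of_nat_mult)
  then have "real (m * n) \<ge> 4"
    using c by simp
  then have mn: "m * n \<ge> 4"
    by linarith
  have matrix: "cartan_matrix a b \<beta>1 \<beta>2 = H m n"
  proof -
    have "2 * form a b \<beta>1 \<beta>2 / form a b \<beta>1 \<beta>1 = - real n"
      by (simp add: n cartan_number_def \<beta>1_def \<beta>2_def form_simps form_commute[of a b "?p j" "?p (j + d)"])
    moreover have "2 * form a b \<beta>2 \<beta>1 / form a b \<beta>2 \<beta>2 = - real m"
      by (simp add: m cartan_number_reversed[OF ab1] \<beta>1_def \<beta>2_def form_simps form_commute[of a b "?p (j + d)" "?p j"])
    ultimately show ?thesis
      using pos by (simp add: cartan_matrix_def H_def)
  qed
  \<comment> \<open>both sides solve the recurrence with coefficients \<open>n\<close> and \<open>m\<close> and agree at \<open>0\<close> and \<open>1\<close>\<close>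
  have coord: "?p (j + d * i) = fst (root_chain m n i) *\<^sub>R \<beta>1 + snd (root_chain m n i) *\<^sub>R \<beta>2" for i
  proof (rule alternating_unique[where k = 0 and c = "real n" and c' = "real m"])
    show "alternating (real n) (real m) (\<lambda>i. ?p (j + d * i))"
      unfolding alternating_def
    proof
      fix i
      have "cartan_number a b (j + d * i) d = (if even i then real n else real m)"
      proof (cases "even i")
        case True
        then have "even (j + d * i) = even j"
          by simp
        from cartan_number_parity[OF ab1 this] show ?thesis
          using True n by simp
      next
        case False
        then have "even (j + d * i) = even (j + d)"
          by simp
        from cartan_number_parity[OF ab1 this] show ?thesis
          using False m by simp
      qed
      then show "?p (j + d * (i + 1)) + ?p (j + d * (i - 1)) = (if even i then real n else real m) *\<^sub>R ?p (j + d * i)"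
        using root_chain_step[OF ab1, of "j + d * i" d] by (simp add: algebra_simps)
    qed
    have "linear (\<lambda>v. fst v *\<^sub>R \<beta>1 + snd v *\<^sub>R \<beta>2)"
      by (rule linearI) (simp_all add: algebra_simps)
    from alternating_linear[OF this root_chain_alternating]
    show "alternating (real n) (real m) (\<lambda>i. fst (root_chain m n i) *\<^sub>R \<beta>1 + snd (root_chain m n i) *\<^sub>R \<beta>2)" .
  qed (simp_all add: root_chain_0 root_chain_1 \<beta>1_def \<beta>2_def)
  have combination: "\<exists>k l :: nat. ?p (j + d * i) = real k *\<^sub>R \<beta>1 + real l *\<^sub>R \<beta>2 \<or>
      ?p (j + d * i) = - (real k *\<^sub>R \<beta>1 + real l *\<^sub>R \<beta>2)" for i
  proof -
    obtain x y where xy: "root_chain m n i = (of_int x, of_int y)"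
      using root_chain_Ints[of m n i] by (metis Ints_cases prod.collapse)
    show ?thesis
    proof (cases "i \<ge> 1")
      case True
      then have "x \<ge> 0" "y \<ge> 0"
        using root_chain_pos[OF mn True] xy by auto
      then show ?thesis
        by (intro exI[of _ "nat x"] exI[of _ "nat y"] disjI1) (simp add: coord xy)
    next
      case False
      then have "x \<le> 0" "y \<le> 0"
        using root_chain_neg[OF mn, of i] xy by auto
      then show ?thesis
        by (intro exI[of _ "nat (- x)"] exI[of _ "nat (- y)"] disjI2) (simp add: coord xy)
    qed
  qed
  have neg: "\<exists>k l :: nat. - v = real k *\<^sub>R \<beta>1 + real l *\<^sub>R \<beta>2 \<or> - v = - (real k *\<^sub>R \<beta>1 + real l *\<^sub>R \<beta>2)"
    if "\<exists>k l :: nat. v = real k *\<^sub>R \<beta>1 + real l *\<^sub>R \<beta>2 \<or> v = - (real k *\<^sub>R \<beta>1 + real l *\<^sub>R \<beta>2)" for v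
    using that by (metis minus_minus)
  have mem: "\<beta>1 \<in> \<Phi>" "\<beta>2 \<in> \<Phi>"
  proof -
    have "j \<in> range (\<lambda>i. j + d * i)" "j + d \<in> range (\<lambda>i. j + d * i)"
      by (rule range_eqI[of _ _ 0], simp) (rule range_eqI[of _ _ 1], simp)
    then show "\<beta>1 \<in> \<Phi>" "\<beta>2 \<in> \<Phi>"
      unfolding \<Phi> signed_chain_def \<beta>1_def \<beta>2_def by blast+
  qed
  have indep: "independent {\<beta>1, \<beta>2}" "\<beta>1 \<noteq> \<beta>2"
  proof -
    have det: "fst \<beta>1 * snd \<beta>2 - fst \<beta>2 * snd \<beta>1 \<noteq> 0"
      using chain_det_pos[OF ab d, of j] by (simp add: chain_det_def \<beta>1_def \<beta>2_def algebra_simps)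
    then show "\<beta>1 \<noteq> \<beta>2"
      by auto
    have "\<beta>1 \<notin> span {\<beta>2}" "\<beta>2 \<noteq> 0"
      using det by (auto simp: span_singleton)
    then show "independent {\<beta>1, \<beta>2}"
      by (simp add: independent_insert)
  qed
  have "\<Phi> = Phi a b {\<beta>1, \<beta>2}"
  proof
    have sub: "{\<beta>1, \<beta>2} \<subseteq> signed_chain a b UNIV"
      using mem unfolding \<Phi> signed_chain_def by blast
    show "Phi a b {\<beta>1, \<beta>2} \<subseteq> \<Phi>"
    proof (rule Phi_subset)
      show "form a b \<gamma> \<gamma> \<noteq> 0" if "\<gamma> \<in> {\<beta>1, \<beta>2}" for \<gamma>
        using that pos by auto
      show "{\<beta>1, \<beta>2} \<subseteq> \<Phi>"
        using mem by simp
      fix \<gamma> x assume "\<gamma> \<in> {\<beta>1, \<beta>2}" "x \<in> \<Phi>"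
      then have "\<gamma> \<in> signed_chain a b (range (\<lambda>i. j + d * i))" "x \<in> signed_chain a b (range (\<lambda>i. j + d * i))"
        using mem unfolding \<Phi> by blast+
      then show "reflection a b \<gamma> x \<in> \<Phi>"
        unfolding \<Phi>
      proof (rule signed_chain_reflection_closed[OF ab1])
        show "2 * k - l \<in> range (\<lambda>i. j + d * i)"
          if "k \<in> range (\<lambda>i. j + d * i)" "l \<in> range (\<lambda>i. j + d * i)" for k l
        proof -
          obtain s t where "k = j + d * s" "l = j + d * t"
            using \<open>k \<in> _\<close> \<open>l \<in> _\<close> by blast
          then have "2 * k - l = j + d * (2 * s - t)"
            by (simp add: algebra_simps)
          then show ?thesis by blast
        qed
      qed
    qed
    obtain J where J: "Phi a b {\<beta>1, \<beta>2} = signed_chain a b J"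
        "\<And>j. ?p j \<in> Phi a b {\<beta>1, \<beta>2} \<longleftrightarrow> j \<in> J"
        "\<And>j k. j \<in> J \<Longrightarrow> k \<in> J \<Longrightarrow> 2 * k - j \<in> J"
      by (rule Phi_eq_signed_chain[OF ab1 sub]) blast
    have in_Phi: "\<beta>1 \<in> Phi a b {\<beta>1, \<beta>2}" "\<beta>2 \<in> Phi a b {\<beta>1, \<beta>2}"
      using subset_Phi[of "{\<beta>1, \<beta>2}" a b] by auto
    have "reflection a b \<beta>1 \<beta>1 \<in> Phi a b {\<beta>1, \<beta>2}"
      using pos in_Phi by (intro Phi_reflection_closed) auto
    then have "j \<in> J"
      using pos(1) by (simp add: reflection_self \<beta>1_def flip: J(2))
    moreover have "j + d \<in> J"
      using in_Phi(2) by (simp add: \<beta>2_def flip: J(2))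
    ultimately have "range (\<lambda>i. j + d * i) \<subseteq> J"
      using progression_subset[of J j d] J(3) by blast
    then show "\<Phi> \<subseteq> Phi a b {\<beta>1, \<beta>2}"
      unfolding \<Phi> J(1) signed_chain_def by blast
  qed
  moreover have "\<forall>\<gamma> \<in> \<Phi>. \<exists>k l :: nat.
      \<gamma> = real k *\<^sub>R \<beta>1 + real l *\<^sub>R \<beta>2 \<or> \<gamma> = - (real k *\<^sub>R \<beta>1 + real l *\<^sub>R \<beta>2)"
  proof
    fix \<gamma> assume "\<gamma> \<in> \<Phi>"
    then obtain i where "\<gamma> = ?p (j + d * i) \<or> \<gamma> = - ?p (j + d * i)"
      unfolding \<Phi> signed_chain_def by blast
    then show "\<exists>k l :: nat. \<gamma> = real k *\<^sub>R \<beta>1 + real l *\<^sub>R \<beta>2 \<or> \<gamma> = - (real k *\<^sub>R \<beta>1 + real l *\<^sub>R \<beta>2)"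
      using combination[of i] neg[OF combination[of i]] by (elim disjE) (simp_all only:)
  qed
  ultimately have "is_simple_basis a b \<Phi> \<beta>1 \<beta>2"
    using mem indep unfolding is_simple_basis_def by blast
  then show ?thesis
    using matrix mn1 unfolding type_H_def by blast
qed

lemma cartan_matrix_swap:
  "cartan_matrix a b u v = H m n \<Longrightarrow> cartan_matrix a b v u = H n m"
  by (simp add: cartan_matrix_def H_def vec_eq_iff forall_2)

lemma type_H_swap:
  assumes "type_H a b \<Phi> m n"
  shows "type_H a b \<Phi> n m"
proof -
  obtain u v where uv: "is_simple_basis a b \<Phi> u v" "cartan_matrix a b u v = H m n" "m \<ge> 1" "n \<ge> 1"
    using assms unfolding type_H_def by blast
  have "is_simple_basis a b \<Phi> v u"
    using uv(1) unfolding is_simple_basis_def insert_commute[of v u] by (metis add.commute)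
  then show ?thesis
    using uv(3,4) cartan_matrix_swap[OF uv(2)] unfolding type_H_def by blast
qed

text \<open>
  The conditions on the product come from \<open>cartan_number_product\<close>. For \<open>a = b\<close> all roots have norm \<open>2\<close>,
  so the Cartan matrix is symmetric.
\<close>

lemma Phi_classification:
  assumes ab: "a * b \<ge> 4" and \<Gamma>: "\<Gamma> \<subseteq> real_roots a b" "\<Gamma> \<noteq> {}"
  shows "type_A1 a b (Phi a b \<Gamma>) \<or>
    (\<exists>m n. type_H a b (Phi a b \<Gamma>) m n \<and> (a * b = 4 \<longrightarrow> m * n = 4) \<and> (a * b > 4 \<longrightarrow> m * n > 4) \<and>
      (a = b \<longrightarrow> m = n))"
proof -
  let ?p = "root_chain a b"
  have ab1: "a \<ge> 1" "b \<ge> 1"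
    using ab by (auto intro!: Suc_leI gr0I)
  have chain: "\<Gamma> \<subseteq> signed_chain a b UNIV"
    using \<Gamma>(1) real_roots_subset_chain[OF ab1] by blast
  obtain J where J: "Phi a b \<Gamma> = signed_chain a b J"
      "\<And>j. ?p j \<in> Phi a b \<Gamma> \<longleftrightarrow> j \<in> J"
      "\<And>j k. j \<in> J \<Longrightarrow> k \<in> J \<Longrightarrow> 2 * k - j \<in> J"
    by (rule Phi_eq_signed_chain[OF ab1 chain]) blast
  obtain \<gamma> where \<gamma>: "\<gamma> \<in> \<Gamma>" "\<gamma> \<in> signed_chain a b J"
    using \<Gamma>(2) subset_Phi[of \<Gamma> a b] J(1) by blast
  then have "J \<noteq> {}"
    by (auto simp: signed_chain_def)
  with J(3) have "(\<exists>j. J = {j}) \<or> (\<exists>j d. d \<ge> 1 \<and> J = range (\<lambda>i. j + d * i))"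
    by (rule reflection_closed_int_set)
  then show ?thesis
  proof (elim disjE exE conjE)
    fix j assume "J = {j}"
    then have "Phi a b \<Gamma> = {\<gamma>, - \<gamma>}"
      using \<gamma>(2) unfolding J(1) signed_chain_def by auto
    then show ?thesis
      using \<gamma>(1) \<Gamma>(1) unfolding type_A1_def by blast
  next
    fix j d assume d: "d \<ge> 1" and progression: "J = range (\<lambda>i. j + d * i)"
    have nat: "\<exists>n. real n = cartan_number a b k d" for k
      using cartan_number_Ints[OF ab1, of k d] cartan_number_pos[OF ab d, of k]
      by (metis Ints_cases less_imp_le of_int_0_le_iff of_int_of_nat_eq zero_le_imp_eq_int)
    then obtain m n where mn: "real n = cartan_number a b j d" "real m = cartan_number a b (j + d) d"
      by metis
    obtain c where c: "c > 0" "real (m * n) = 4 + c * (real (a * b) - 4) * (chain_det a b j (j + d))\<^sup>2"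
      using cartan_number_product[OF ab1, of j d] mn by (metis mult.commute of_nat_mult)
    have det: "chain_det a b j (j + d) > 0"
      by (rule chain_det_pos[OF ab d])
    show ?thesis
    proof (intro disjI2 exI conjI impI)
      show "type_H a b (Phi a b \<Gamma>) m n"
        unfolding J(1) progression by (rule type_H_root_chain_progression[OF ab d refl mn])
      show "m * n = 4" if "a * b = 4"
      proof -
        have "real (a * b) = 4" using that by simp
        then have "real (m * n) = 4" using c(2) by simp
        then show ?thesis by linarith
      qed
      show "m * n > 4" if "a * b > 4"
      proof -
        have "real (a * b) > 4" using that by linarith
        then have "real (m * n) > 4" using c det by simp
        then show ?thesis by linarith
      qed
      show "m = n" if "a = b"
      proof -
        have "form a b (?p j) (?p j) = form a b (?p (j + d)) (?p (j + d))"
          using that ab1 by (simp add: form_root_chain)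
        then have "real m = real n"
          unfolding mn cartan_number_reversed[OF ab1]
          by (simp add: cartan_number_def form_commute[of a b "?p j" "?p (j + d)"])
        then show ?thesis by simp
      qed
    qed
  qed
qed

text \<open>
  Completing the square in either variable bounds the coordinates of an integral vector by its norm,
  because \<open>4 - ab \<ge> 1\<close>. With \<open>a, b \<le> 3\<close> and norm \<open>2a/b\<close> or \<open>2\<close>, both coordinates lie between \<open>-4\<close> and
  \<open>4\<close>.
\<close>

lemma finite_signed_chain:
  assumes "a \<ge> 1" "b \<ge> 1" "a * b < 4"
  shows "finite (signed_chain a b UNIV)"
proof -
  let ?box = "(\<lambda>(x, y). (of_int x, of_int y)) ` ({-4..4} \<times> {-4..4} :: (int \<times> int) set) :: root_space set"
  have "a \<le> a * b" "b \<le> a * b"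
    using assms(1,2) by simp_all
  then have le3: "real a \<le> 3" "real b \<le> 3"
    using assms(3) by linarith+
  have ab1: "real a \<ge> 1" "real b \<ge> 1"
    using assms(1,2) by simp_all
  have def1: "4 - real a * real b \<ge> 1"
    using assms(3) by (simp flip: of_nat_mult)
  have bound: "root_chain a b k \<in> ?box" for k
  proof -
    obtain x y where xy: "root_chain a b k = (of_int x, of_int y)"
      using root_chain_Ints[of a b k] by (metis Ints_cases prod.collapse)
    let ?x = "real_of_int x" and ?y = "real_of_int y"
    let ?F = "form a b (?x, ?y) (?x, ?y)"
    have "real b * ?F = 2 * real a \<or> real b * ?F = 2 * real b"
      using form_root_chain(1)[OF assms(2), of a k] assms(2) unfolding xy by auto
    then have F: "2 * (real b * ?F) \<le> 4 * real a + 4 * real b"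
      by auto
    have "2 * (real b * ?F) = real b * (2 * ?y - real a * ?x)\<^sup>2 + (4 - real a * real b) * (real a * ?x\<^sup>2)"
      using assms(2) by (simp add: form_def field_simps power2_eq_square)
    moreover have "1 * (real a * ?x\<^sup>2) \<le> (4 - real a * real b) * (real a * ?x\<^sup>2)"
      using def1 by (intro mult_right_mono) auto
    moreover have "real b * (2 * ?y - real a * ?x)\<^sup>2 \<ge> 0"
      by simp
    ultimately have "real a * ?x\<^sup>2 \<le> 4 * real a + 4 * real b"
      using F by linarith
    also have "\<dots> \<le> real a * (4 + 4 * real b)"
      using ab1 by (simp add: algebra_simps)
    finally have "real a * ?x\<^sup>2 \<le> real a * (4 + 4 * real b)" .
    then have x: "?x\<^sup>2 \<le> 4\<^sup>2"
      using ab1 le3 by (simp add: mult_le_cancel_left_pos)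
    have "2 * (real b * ?F) = real a * (2 * ?x - real b * ?y)\<^sup>2 + (4 - real a * real b) * (real b * ?y\<^sup>2)"
      using assms(2) by (simp add: form_def field_simps power2_eq_square)
    moreover have "1 * (real b * ?y\<^sup>2) \<le> (4 - real a * real b) * (real b * ?y\<^sup>2)"
      using def1 by (intro mult_right_mono) auto
    moreover have "real a * (2 * ?x - real b * ?y)\<^sup>2 \<ge> 0"
      by simp
    ultimately have "real b * ?y\<^sup>2 \<le> 4 * real a + 4 * real b"
      using F by linarith
    also have "\<dots> \<le> real b * (4 + 4 * real a)"
      using ab1 by (simp add: algebra_simps)
    finally have "real b * ?y\<^sup>2 \<le> real b * (4 + 4 * real a)" .
    then have y: "?y\<^sup>2 \<le> 4\<^sup>2"
      using ab1 le3 by (simp add: mult_le_cancel_left_pos)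
    have "\<bar>?x\<bar> \<le> 4" "\<bar>?y\<bar> \<le> 4"
      using x y abs_le_square_iff[of ?x 4] abs_le_square_iff[of ?y 4] by simp_all
    then have "x \<in> {-4..4}" "y \<in> {-4..4}"
      by auto
    then show ?thesis
      unfolding xy by force
  qed
  have "signed_chain a b UNIV \<subseteq> ?box \<union> uminus ` ?box"
    using bound by (auto simp: signed_chain_def)
  then show ?thesis
    by (rule finite_subset) simp
qed

lemma Phi_finite:
  assumes "a \<ge> 1" "b \<ge> 1" "a * b < 4" "\<Gamma> \<subseteq> real_roots a b"
  shows "finite (Phi a b \<Gamma>)"
proof -
  have "\<Gamma> \<subseteq> signed_chain a b UNIV"
    using assms(4) real_roots_subset_chain[OF assms(1,2)] by blast
  then obtain J where "Phi a b \<Gamma> = signed_chain a b J"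
    by (rule Phi_eq_signed_chain[OF assms(1,2)])
  moreover have "signed_chain a b J \<subseteq> signed_chain a b UNIV"
    by (auto simp: signed_chain_def)
  ultimately show ?thesis
    using finite_signed_chain[OF assms(1-3)] finite_subset by metis
qed

section \<open>Classification of root subsystems\<close>

theorem theorem1p4:
  fixes a b :: nat and \<Gamma> :: "root_space set"
  assumes "a \<ge> b" and "b \<ge> 1"
    and "\<Gamma> \<subseteq> real_roots a b" and "\<Gamma> \<noteq> {}"
  shows "(ambient_finite a b \<longrightarrow> finite (Phi a b \<Gamma>)) \<and>
    (ambient_affine_A1 a b \<longrightarrow>
       type_A1 a b (Phi a b \<Gamma>) \<or> type_affine_A1 a b (Phi a b \<Gamma>)) \<and>
    (ambient_affine_A22 a b \<longrightarrow>
       type_A1 a b (Phi a b \<Gamma>) \<or> type_affine_A1 a b (Phi a b \<Gamma>) \<or>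
       type_affine_A22 a b (Phi a b \<Gamma>)) \<and>
    (ambient_hyperbolic a b \<longrightarrow>
       type_A1 a b (Phi a b \<Gamma>) \<or> type_hyperbolic a b (Phi a b \<Gamma>))"
proof (intro conjI impI)
  have a: "a \<ge> 1" using assms(1,2) by simp
  note classify = Phi_classification[OF _ assms(3,4)]
  show "finite (Phi a b \<Gamma>)" if "ambient_finite a b"
    using that a assms(2,3) by (intro Phi_finite) (auto simp: ambient_finite_def)
  show "type_A1 a b (Phi a b \<Gamma>) \<or> type_affine_A1 a b (Phi a b \<Gamma>)" if "ambient_affine_A1 a b"
  proof -
    have eq: "a = 2" "b = 2" using that by (auto simp: ambient_affine_A1_def)
    \<comment> \<open>equal lengths force \<open>m = n\<close>, and then \<open>mn = 4\<close> leaves only \<open>(2,2)\<close>\<close>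
    have "n = 2" if "n * n = 4" for n :: nat
      using that by (metis power2_eq_iff_nonneg power2_eq_square zero_le mult_2_right numeral_Bit0 mult_2)
    then show ?thesis
      using classify eq unfolding type_affine_A1_def by fastforce
  qed
  show "type_A1 a b (Phi a b \<Gamma>) \<or> type_affine_A1 a b (Phi a b \<Gamma>) \<or> type_affine_A22 a b (Phi a b \<Gamma>)"
    if "ambient_affine_A22 a b"
  proof -
    have eq: "a * b = 4" using that by (auto simp: ambient_affine_A22_def)
    have "m = 1 \<and> n = 4 \<or> m = 2 \<and> n = 2 \<or> m = 4 \<and> n = 1" if "m * n = 4" for m n :: nat
    proof -
      have "m dvd 4" "n dvd 4" using that by (metis dvd_triv_left dvd_triv_right)+
      then have "m \<le> 4" "n \<le> 4" by (simp_all add: dvd_imp_le)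
      then have "m \<in> {0, 1, 2, 3, 4}" "n \<in> {0, 1, 2, 3, 4}" by auto
      with that show ?thesis by auto
    qed
    \<comment> \<open>\<open>(1,4)\<close> becomes \<open>(4,1)\<close> after exchanging the two simple roots\<close>
    then show ?thesis
      using classify eq type_H_swap unfolding type_affine_A1_def type_affine_A22_def by (metis order_refl)
  qed
  show "type_A1 a b (Phi a b \<Gamma>) \<or> type_hyperbolic a b (Phi a b \<Gamma>)" if "ambient_hyperbolic a b"
    using that classify unfolding ambient_hyperbolic_def type_hyperbolic_def by (metis less_imp_le)
qed

end
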